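(* Let $X^\star\in\mathbb{R}^{d\times r^\star}$ be a full-rank matrix (full column rank $r^\star$), put $r=r^\star$, let $F_{\mathrm{sym}}:\mathbb{R}^{d\times r}\to\mathbb{R}^{d\times d\times d}$, $F_{\mathrm{sym}}(X)=\sum_{j=1}^rX_j\otimes X_j\otimes X_j$, and set $T^\star=F_{\mathrm{sym}}(X^\star)$. Then $F_{\mathrm{sym}}$ is continuously differentiable and $$\|\nabla F_{\mathrm{sym}}(X)-\nabla F_{\mathrm{sym}}(\tilde X)\|_{\mathrm{op}}\le12\|X^\star\|_F\,\|X-\tilde X\|_F\quad\text{for all }X,\tilde X\in B_{\|X^\star\|_F}(X^\star).$$ Moreover, $F_{\mathrm{sym}}$ is locally strongly aligned at $X^\star$ with $$\varepsilon_{x^\star}=\min\left\{R,\frac{\sigma_{dr}(\nabla F_{\mathrm{sym}}(X^\star))}{24\|X^\star\|_F},\|X^\star\|_F\right\},\qquad\delta(\rho)=\frac{\rho}{C},\qquad s=\frac12\,\sigma_{dr}(\nabla F_{\mathrm{sym}}(X^\star))$$ for some constants $R,C>0$ that depend only on $X^\star$.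
   Context: $X_j$ is the $j$-th column of $X$; $(w\otimes x\otimes y)_{ijk}=w_ix_jy_k$; $\|\cdot\|_F$ is the $\ell_2$ norm of the entries of a matrix or tensor, and these spaces carry the corresponding inner product. $\nabla F(x)$ is the derivative of $F$ at $x$ as a linear map, $\sigma_k(\cdot)$ the $k$-th largest singular value. Fix for each $x$ an SVD of $\nabla F(x)$ with singular values $\sigma_1^x\ge\sigma_2^x\ge\cdots$, and let $\Pi_j^x$ be the orthogonal projection onto the span of its top $j$ left singular vectors. $B_t(z)$ is the closed ball of radius $t$ around $z$, $\mathbb{R}_+$ the positive reals. $F$ is locally strongly aligned at $x^\star$ (with $z^\star=F(x^\star)$) with function $\delta:\mathbb{R}_+\to\mathbb{R}_+$ and scalars $\varepsilon_{x^\star},s>0$ if for all $\rho>0$: whenever $x\in B_{\varepsilon_{x^\star}}(x^\star)$ and $z=F(x)\in B_{\delta(\rho)}(z^\star)$, there is an index $j$ such that $\|(I-\Pi^x_j)(z-z^\star)\|\le\rho\|z-z^\star\|$ and $(\sigma^x_j)^2\ge s$.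
   Formalization: The printed s = σ/2, with σ = σ_{dr}(∇F_sym(X* )), is false in general (e.g. d = r = 1, X* = 1/10); the formal theorem proves alignment with s = (σ/2)² for every full-rank X*, and with the printed s = σ/2 whenever σ > 1/2. *)

theory Defs
  imports "HOL-Analysis.Analysis"
begin

definition outer3 :: "real^'l \<Rightarrow> real^'m \<Rightarrow> real^'n \<Rightarrow> real^'n^'m^'l" where
  "outer3 w x y = (\<chi> i j k. w $ i * x $ j * y $ k)"

text \<open>The norm and inner product of the nested vector types \<open>real^'r^'d\<close> and
  \<open>real^'d^'d^'d\<close> are the Frobenius ones.\<close>

definition F_sym :: "real^'r^'d \<Rightarrow> real^'d^'d^'d" where
  "F_sym X = (\<Sum>j\<in>UNIV. outer3 (column j X) (column j X) (column j X))"

text \<open>The derivative is a bounded linear map, so its \<open>norm\<close> is the operator norm.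
  It is meaningful only where \<open>F\<close> is differentiable.\<close>

definition nabla ::
  "('a::euclidean_space \<Rightarrow> 'b::euclidean_space) \<Rightarrow> 'a \<Rightarrow> ('a \<Rightarrow>\<^sub>L 'b)" where
  "nabla F x = Blinfun (frechet_derivative F (at x))"

definition continuously_differentiable ::
  "('a::euclidean_space \<Rightarrow> 'b::euclidean_space) \<Rightarrow> bool" where
  "continuously_differentiable F \<longleftrightarrow>
     (\<forall>x. F differentiable (at x)) \<and> continuous_on UNIV (nabla F)"

definition orthonormal_upto :: "nat \<Rightarrow> (nat \<Rightarrow> 'a::real_inner) \<Rightarrow> bool" where
  "orthonormal_upto m u \<longleftrightarrow>
     (\<forall>i\<in>{1..m}. \<forall>k\<in>{1..m}. u i \<bullet> u k = (if i = k then 1 else 0))"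

text \<open>Singular values and vectors are indexed from 1 to the smaller of the two dimensions;
  values of \<open>u\<close>, \<open>\<sigma>\<close>, \<open>v\<close> outside this range are irrelevant.\<close>

definition is_svd ::
  "('a::euclidean_space \<Rightarrow>\<^sub>L 'b::euclidean_space) \<Rightarrow> (nat \<Rightarrow> 'b) \<Rightarrow> (nat \<Rightarrow> real) \<Rightarrow> (nat \<Rightarrow> 'a) \<Rightarrow> bool"
where
  "is_svd A u \<sigma> v \<longleftrightarrow>
     (let m = min DIM('a) DIM('b) in
        orthonormal_upto m u \<and> orthonormal_upto m v \<and>
        (\<forall>i\<in>{1..m}. 0 \<le> \<sigma> i) \<and>
        (\<forall>i\<in>{1..m}. \<forall>k\<in>{1..m}. i \<le> k \<longrightarrow> \<sigma> k \<le> \<sigma> i) \<and>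
        (\<forall>h. blinfun_apply A h = (\<Sum>i=1..m. (\<sigma> i * (v i \<bullet> h)) *\<^sub>R u i)))"

text \<open>The \<open>k\<close>-th largest singular value, for \<open>1 \<le> k \<le> min DIM('a) DIM('b)\<close>. The description
  is proper because every linear map has an SVD and its singular values do not depend on
  the choice of the SVD.\<close>

definition singular_value ::
  "('a::euclidean_space \<Rightarrow>\<^sub>L 'b::euclidean_space) \<Rightarrow> nat \<Rightarrow> real" where
  "singular_value A k = (THE t. \<exists>u \<sigma> v. is_svd A u \<sigma> v \<and> t = \<sigma> k)"

definition orth_proj :: "'a::euclidean_space set \<Rightarrow> 'a \<Rightarrow> 'a" where
  "orth_proj S y = (THE p. p \<in> S \<and> (\<forall>w\<in>S. (y - p) \<bullet> w = 0))"

text \<open>A fixed choice of an SVD of the derivative at every point.\<close>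

definition svd_family ::
  "('a::euclidean_space \<Rightarrow> 'b::euclidean_space) \<Rightarrow>
   ('a \<Rightarrow> nat \<Rightarrow> 'b) \<Rightarrow> ('a \<Rightarrow> nat \<Rightarrow> real) \<Rightarrow> ('a \<Rightarrow> nat \<Rightarrow> 'a) \<Rightarrow> bool" where
  "svd_family F U S V \<longleftrightarrow> (\<forall>x. is_svd (nabla F x) (U x) (S x) (V x))"

text \<open>Here \<open>U x\<close> and \<open>S x\<close> are the left singular vectors and the singular values of
  the derivative at \<open>x\<close>, taken from a fixed SVD family.\<close>

definition locally_strongly_aligned ::
  "('a::euclidean_space \<Rightarrow> 'b::euclidean_space) \<Rightarrow> ('a \<Rightarrow> nat \<Rightarrow> 'b) \<Rightarrow> ('a \<Rightarrow> nat \<Rightarrow> real) \<Rightarrow>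
   'a \<Rightarrow> (real \<Rightarrow> real) \<Rightarrow> real \<Rightarrow> real \<Rightarrow> bool" where
  "locally_strongly_aligned F U S xs \<delta> \<epsilon> s \<longleftrightarrow>
     (\<forall>\<rho>>0. 0 < \<delta> \<rho>) \<and> 0 < \<epsilon> \<and> 0 < s \<and>
     (\<forall>\<rho>>0. \<forall>x\<in>cball xs \<epsilon>. F x \<in> cball (F xs) (\<delta> \<rho>) \<longrightarrow>
        (\<exists>j\<in>{1..min DIM('a) DIM('b)}.
           norm ((F x - F xs) - orth_proj (span (U x ` {1..j})) (F x - F xs))
             \<le> \<rho> * norm (F x - F xs) \<and>
           s \<le> (S x j)\<^sup>2))"

end

theory Submission
  imports Defs
begin

text \<open>
  Everything rests on the trilinear map \<open>cp3 A B C = (\<Sum>j. A\<^sub>j \<otimes> B\<^sub>j \<otimes> C\<^sub>j)\<close>. The Cauchy--Schwarz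
  inequality gives \<open>norm (cp3 A B C) \<le> norm A * norm B * norm C\<close>, and \<open>F_sym X = cp3 X X X\<close> has
  the derivative \<open>H \<mapsto> cp3 H X X + cp3 X H X + cp3 X X H\<close>. Subtracting two such derivatives and
  telescoping each of the three terms yields the bound
  \<open>3 * (norm X + norm X') * norm (X - X')\<close> on the difference; it makes the derivative
  continuous, and on the ball of radius \<open>norm Xs\<close> around \<open>Xs\<close> it is the Lipschitz bound with
  constant \<open>L = 12 * norm Xs\<close>.

  If \<open>Xs\<close> has full column rank, it has a left inverse, whose rows form a system dual to the columns
  of \<open>Xs\<close>. Contracting \<open>\<nabla>F_sym(Xs) H\<close> twice with a dual vector isolates a single column of \<open>H\<close>, so
  \<open>\<nabla>F_sym(Xs)\<close> is injective, which means that its smallest singular value \<open>\<sigma>\<close> is positive.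

  Strong alignment is then a general fact about maps whose derivative is Lipschitz near \<open>xs\<close> and
  injective at \<open>xs\<close> (lemma \<open>aligned_if_derivative_injective\<close>). All singular vectors are
  used: the index is the dimension of the domain. Let \<open>h = x - xs\<close> and \<open>z = F x - F xs\<close>.
  The span of all left singular vectors contains the range of \<open>\<nabla>F(x)\<close>, hence the residual of \<open>z\<close>
  is at most \<open>norm (z - \<nabla>F(x) h) \<le> L * (norm h)\<^sup>2\<close>. For \<open>norm h \<le> \<sigma> / (2 * L)\<close> the
  linearization at \<open>xs\<close> gives \<open>norm z \<ge> \<sigma> / 2 * norm h\<close>. So the residual is at most
  \<open>4 * L / \<sigma>\<^sup>2 * (norm z)\<^sup>2\<close>, which is at most \<open>\<rho> * norm z\<close> as soon as \<open>norm z \<le> \<rho> / C\<close> with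
  \<open>C = 4 * L / \<sigma>\<^sup>2\<close>. The smallest singular value at \<open>x\<close> is at least \<open>\<sigma> - L * norm h \<ge> \<sigma> / 2\<close>. When
  \<open>\<sigma> > 1/2\<close>, its square even stays above \<open>\<sigma> / 2\<close> if \<open>R\<close> is small enough, because
  \<open>\<sigma>\<^sup>2 > \<sigma> / 2\<close>.
\<close>

section \<open>The smallest singular value of an injective linear map\<close>

lemma orthonormal_upto_norm_sum:
  assumes "orthonormal_upto m u"
  shows "(norm (\<Sum>i=1..m. c i *\<^sub>R u i))\<^sup>2 = (\<Sum>i=1..m. (c i)\<^sup>2)"
proof -
  have "(norm (\<Sum>i=1..m. c i *\<^sub>R u i))\<^sup>2 = (\<Sum>i=1..m. \<Sum>k=1..m. c i * (c k * (u k \<bullet> u i)))"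
    by (simp add: power2_norm_eq_inner inner_sum_left inner_sum_right sum_distrib_left)
  also have "\<dots> = (\<Sum>i=1..m. \<Sum>k=1..m. if i = k then (c i)\<^sup>2 else 0)"
    using assms by (intro sum.cong refl) (auto simp: orthonormal_upto_def power2_eq_square)
  finally show ?thesis by simp
qed

lemma orthonormal_upto_DIM_expansion:
  fixes v :: "nat \<Rightarrow> 'a::euclidean_space"
  assumes v: "orthonormal_upto DIM('a) v"
  shows "(\<Sum>i=1..DIM('a). (v i \<bullet> h) *\<^sub>R v i) = h"
proof -
  let ?I = "{1..DIM('a)}"
  have unit: "v i \<bullet> v k = (if i = k then 1 else 0)" if "i \<in> ?I" "k \<in> ?I" for i k
    using v that by (simp add: orthonormal_upto_def)
  have inj: "inj_on v ?I"
    by (metis inj_onI unit zero_neq_one)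
  have "independent (v ` ?I)"
  proof (rule pairwise_orthogonal_independent)
    show "pairwise orthogonal (v ` ?I)"
      by (auto simp: pairwise_def orthogonal_def unit)
    show "0 \<notin> v ` ?I"
      using unit by (metis imageE inner_zero_left zero_neq_one)
  qed
  then have "dim (v ` ?I) = DIM('a)"
    using card_image[OF inj] by (simp add: dim_eq_card_independent)
  then have span: "span (v ` ?I) = UNIV"
    by (simp only: dim_eq_full)
  let ?y = "(\<Sum>i\<in>?I. (v i \<bullet> h) *\<^sub>R v i) - h"
  have "orthogonal ?y w" if "w \<in> v ` ?I" for w
  proof -
    from that obtain k where k: "k \<in> ?I" "w = v k" by auto
    have *: "(\<Sum>i\<in>?I. (v i \<bullet> h) * (v i \<bullet> v k)) = (\<Sum>i\<in>?I. if i = k then v k \<bullet> h else 0)"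
      using k unit by (intro sum.cong refl) auto
    have "?y \<bullet> v k = (\<Sum>i\<in>?I. (v i \<bullet> h) * (v i \<bullet> v k)) - h \<bullet> v k"
      by (simp add: inner_diff_left inner_sum_left)
    also have "\<dots> = 0"
      unfolding * using k(1) by (simp add: inner_commute)
    finally show ?thesis
      using k by (simp add: orthogonal_def)
  qed
  then have "orthogonal ?y ?y"
    using orthogonal_to_span[of ?y "v ` ?I" ?y] span by auto
  then show ?thesis by (simp add: orthogonal_def)
qed

lemma is_svd_norm_apply:
  fixes A :: "'a::euclidean_space \<Rightarrow>\<^sub>L 'b::euclidean_space"
  assumes svd: "is_svd A u s v" and dim: "DIM('a) \<le> DIM('b)"
  shows "(norm (blinfun_apply A h))\<^sup>2 = (\<Sum>i=1..DIM('a). (s i * (v i \<bullet> h))\<^sup>2)"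
  using svd dim orthonormal_upto_norm_sum[of "DIM('a)" u "\<lambda>i. s i * (v i \<bullet> h)"]
  by (simp add: is_svd_def Let_def min_absorb1)

lemma is_svd_last_lower:
  fixes A :: "'a::euclidean_space \<Rightarrow>\<^sub>L 'b::euclidean_space"
  assumes svd: "is_svd A u s v" and dim: "DIM('a) \<le> DIM('b)"
  shows "s DIM('a) * norm h \<le> norm (blinfun_apply A h)"
proof -
  let ?m = "DIM('a)"
  have v: "orthonormal_upto ?m v" and s0: "\<And>i. i \<in> {1..?m} \<Longrightarrow> 0 \<le> s i"
    and mono: "\<And>i. i \<in> {1..?m} \<Longrightarrow> s ?m \<le> s i"
    using svd dim by (auto simp: is_svd_def Let_def min_absorb1)
  have sm: "0 \<le> s ?m" using s0[of ?m] by (simp add: Suc_leI)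
  have "(s ?m * norm h)\<^sup>2 = (s ?m)\<^sup>2 * (\<Sum>i=1..?m. (v i \<bullet> h)\<^sup>2)"
    using orthonormal_upto_norm_sum[OF v, of "\<lambda>i. v i \<bullet> h"] orthonormal_upto_DIM_expansion[OF v, of h]
    by (simp add: power_mult_distrib)
  also have "\<dots> = (\<Sum>i=1..?m. (s ?m)\<^sup>2 * (v i \<bullet> h)\<^sup>2)"
    by (simp add: sum_distrib_left)
  also have "\<dots> \<le> (\<Sum>i=1..?m. (s i * (v i \<bullet> h))\<^sup>2)"
    unfolding power_mult_distrib
    by (intro sum_mono mult_right_mono power_mono mono sm) auto
  also have "\<dots> = (norm (blinfun_apply A h))\<^sup>2"
    using is_svd_norm_apply[OF svd dim] by simp
  finally show ?thesis by (rule power2_le_imp_le) simp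
qed

lemma is_svd_last_attained:
  fixes A :: "'a::euclidean_space \<Rightarrow>\<^sub>L 'b::euclidean_space"
  assumes svd: "is_svd A u s v" and dim: "DIM('a) \<le> DIM('b)"
  shows "norm (v DIM('a)) = 1" "norm (blinfun_apply A (v DIM('a))) = s DIM('a)"
proof -
  let ?m = "DIM('a)"
  have m: "?m \<in> {1..?m}" by (simp add: Suc_leI)
  have v: "\<And>i k. i \<in> {1..?m} \<Longrightarrow> k \<in> {1..?m} \<Longrightarrow> v i \<bullet> v k = (if i = k then 1 else 0)"
    and sm: "0 \<le> s ?m"
    using svd dim m by (auto simp: is_svd_def Let_def min_absorb1 orthonormal_upto_def)
  show "norm (v ?m) = 1" using v[OF m m] by (simp add: norm_eq_1)
  have "(norm (blinfun_apply A (v ?m)))\<^sup>2 = (\<Sum>i=1..?m. if i = ?m then (s ?m)\<^sup>2 else 0)"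
    unfolding is_svd_norm_apply[OF svd dim] using m v by (intro sum.cong refl) auto
  also have "\<dots> = (s ?m)\<^sup>2" using m by simp
  finally show "norm (blinfun_apply A (v ?m)) = s ?m"
    using sm by (simp add: power2_eq_iff_nonneg)
qed

text \<open>The last singular value is the minimum of \<open>norm (A h)\<close> over unit vectors \<open>h\<close>, a description
  that does not mention the decomposition; hence any one decomposition determines it.\<close>

lemma singular_value_last:
  fixes A :: "'a::euclidean_space \<Rightarrow>\<^sub>L 'b::euclidean_space"
  assumes svd: "is_svd A u s v" and dim: "DIM('a) \<le> DIM('b)"
  shows "singular_value A DIM('a) = s DIM('a)"
proof -
  have le: "s1 DIM('a) \<le> s2 DIM('a)" if "is_svd A u1 s1 v1" "is_svd A u2 s2 v2"
    for u1 s1 v1 u2 s2 v2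
    using is_svd_last_lower[OF that(1) dim, of "v2 DIM('a)"] is_svd_last_attained[OF that(2) dim]
    by simp
  show ?thesis
    unfolding singular_value_def
  proof (rule the_equality)
    show "\<exists>u' s' v'. is_svd A u' s' v' \<and> s DIM('a) = s' DIM('a)"
      using svd by blast
    show "t = s DIM('a)" if "\<exists>u' s' v'. is_svd A u' s' v' \<and> t = s' DIM('a)" for t
      using that le[OF svd] le[OF _ svd] by (metis order_antisym)
  qed
qed

lemma is_svd_range_subset:
  fixes A :: "'a::euclidean_space \<Rightarrow>\<^sub>L 'b::euclidean_space"
  assumes "is_svd A u s v" "DIM('a) \<le> DIM('b)"
  shows "blinfun_apply A h \<in> span (u ` {1..DIM('a)})"
proof -
  have "blinfun_apply A h = (\<Sum>i=1..DIM('a). (s i * (v i \<bullet> h)) *\<^sub>R u i)"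
    using assms by (simp add: is_svd_def Let_def min_absorb1)
  also have "\<dots> \<in> span (u ` {1..DIM('a)})"
    by (intro span_sum span_scale span_base) auto
  finally show ?thesis .
qed

lemma orth_proj_span_nearest:
  fixes y :: "'a::euclidean_space"
  assumes w: "w \<in> span B"
  shows "norm (y - orth_proj (span B) y) \<le> norm (y - w)"
proof -
  obtain p q where p: "p \<in> span B" and "\<And>w. w \<in> span B \<Longrightarrow> orthogonal q w" "y = p + q"
    using orthogonal_subspace_decomp_exists[of B y] by metis
  then have perp: "(y - p) \<bullet> w = 0" if "w \<in> span B" for w
    using that by (simp add: orthogonal_def)
  have nearest: "norm (y - p) \<le> norm (y - w)" if "w \<in> span B" for w
  proof -
    have "orthogonal (y - p) (p - w)"
      unfolding orthogonal_def using p that by (intro perp span_diff)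
    then have "(norm (y - w))\<^sup>2 = (norm (y - p))\<^sup>2 + (norm (p - w))\<^sup>2"
      using norm_add_Pythagorean[of "y - p" "p - w"] by simp
    then show ?thesis by (intro power2_le_imp_le[OF _ norm_ge_zero]) simp
  qed
  have "orth_proj (span B) y = p"
    unfolding orth_proj_def
  proof (rule the_equality)
    show "p \<in> span B \<and> (\<forall>w\<in>span B. (y - p) \<bullet> w = 0)"
      using p perp by blast
    fix p' assume p': "p' \<in> span B \<and> (\<forall>w\<in>span B. (y - p') \<bullet> w = 0)"
    then have d: "p' - p \<in> span B" using p by (simp add: span_diff)
    have "(p' - p) \<bullet> (p' - p) = (y - p) \<bullet> (p' - p) - (y - p') \<bullet> (p' - p)"
      by (simp flip: inner_diff_left)
    also have "\<dots> = 0" using perp[OF d] p' d by simp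
    finally have "(p' - p) \<bullet> (p' - p) = 0" .
    then show "p' = p" by simp
  qed
  then show ?thesis using nearest[OF w] by simp
qed

section \<open>Strong alignment at points with injective derivative\<close>

lemma nabla_has_derivative:
  assumes "F differentiable at x"
  shows "(F has_derivative blinfun_apply (nabla F x)) (at x)"
  using assms unfolding nabla_def
  by (metis bounded_linear_Blinfun_apply frechet_derivative_works has_derivative_bounded_linear)

lemma nabla_eqI:
  assumes "(F has_derivative F') (at x)"
  shows "blinfun_apply (nabla F x) = F'"
  using assms unfolding nabla_def
  by (metis bounded_linear_Blinfun_apply frechet_derivative_at has_derivative_bounded_linear)

text \<open>The base point of the linearization may be any point of the segment from \<open>xs\<close> to \<open>x\<close>. Both
  ends are needed: linearizing at \<open>x\<close> bounds the residual of the projection, linearizing at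
  \<open>xs\<close> bounds \<open>norm (F x - F xs)\<close> from below.\<close>

lemma linearization_bound:
  fixes F :: "'a::euclidean_space \<Rightarrow> 'b::euclidean_space"
  assumes diff: "\<And>x. F differentiable at x"
    and lip: "\<And>y y'. y \<in> cball xs r \<Longrightarrow> y' \<in> cball xs r \<Longrightarrow>
                norm (nabla F y - nabla F y') \<le> L * norm (y - y')"
    and x: "x \<in> cball xs r" and x0: "x0 \<in> closed_segment xs x" and L: "0 \<le> L"
  shows "norm (F x - F xs - blinfun_apply (nabla F x0) (x - xs)) \<le> L * (norm (x - xs))\<^sup>2"
proof -
  have r: "0 \<le> r" using x zero_le_dist[of xs x] by (simp del: zero_le_dist)
  have sub: "closed_segment xs x \<subseteq> cball xs r"
    using x r by (intro closed_segment_subset) auto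
  have "norm (F x - F xs - blinfun_apply (nabla F x0) (x - xs)) \<le> norm (x - xs) * (L * norm (x - xs))"
  proof (rule differentiable_bound_linearization[where S = "closed_segment xs x"
        and f' = "\<lambda>y. blinfun_apply (nabla F y)"])
    show "xs + t *\<^sub>R (x - xs) \<in> closed_segment xs x" if "t \<in> {0..1}" for t
    proof -
      have "xs + t *\<^sub>R (x - xs) = (1 - t) *\<^sub>R xs + t *\<^sub>R x" by (simp add: algebra_simps)
      then show ?thesis using that unfolding closed_segment_def by auto
    qed
    show "(F has_derivative blinfun_apply (nabla F y)) (at y within closed_segment xs x)" for y
      by (rule has_derivative_at_withinI[OF nabla_has_derivative[OF diff]])
    show "x0 \<in> closed_segment xs x" by (rule x0)
    fix y assume y: "y \<in> closed_segment xs x"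
    have "onorm (blinfun_apply (nabla F y) - blinfun_apply (nabla F x0)) = norm (nabla F y - nabla F x0)"
      by (simp add: norm_blinfun.rep_eq minus_blinfun.rep_eq fun_diff_def)
    also have "\<dots> \<le> L * norm (y - x0)"
      using y x0 sub by (intro lip) auto
    also have "\<dots> \<le> L * norm (x - xs)"
    proof (intro mult_left_mono L)
      obtain a b where "0 \<le> a" "a \<le> 1" "0 \<le> b" "b \<le> 1"
        and ends: "y = (1 - a) *\<^sub>R xs + a *\<^sub>R x" "x0 = (1 - b) *\<^sub>R xs + b *\<^sub>R x"
        using y x0 unfolding closed_segment_def by blast
      moreover have "y - x0 = (a - b) *\<^sub>R (x - xs)"
        unfolding ends by (simp add: algebra_simps)
      ultimately show "norm (y - x0) \<le> norm (x - xs)"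
        by (simp add: mult_left_le_one_le)
    qed
    finally show "onorm (blinfun_apply (nabla F y) - blinfun_apply (nabla F x0)) \<le> L * norm (x - xs)" .
  qed
  then show ?thesis by (simp add: power2_eq_square algebra_simps)
qed

text \<open>On the ball all singular values are at least \<open>\<sigma> - L * \<epsilon>\<close>. The parameter \<open>t\<close> is any
  positive number up to that bound, since both \<open>\<sigma> / 2\<close> and \<open>sqrt (\<sigma> / 2)\<close> are wanted as its value.\<close>

lemma aligned_if_derivative_injective:
  fixes F :: "'a::euclidean_space \<Rightarrow> 'b::euclidean_space"
  assumes dim: "DIM('a) \<le> DIM('b)"
    and diff: "\<And>x. F differentiable at x"
    and lip: "\<And>y y'. y \<in> cball xs r \<Longrightarrow> y' \<in> cball xs r \<Longrightarrow>
                norm (nabla F y - nabla F y') \<le> L * norm (y - y')"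
    and L: "0 < L"
    and svd: "svd_family F U S V"
    and \<sigma>: "\<sigma> = S xs DIM('a)" "0 < \<sigma>"
    and \<epsilon>: "0 < \<epsilon>" "\<epsilon> \<le> r" "\<epsilon> \<le> \<sigma> / (2 * L)"
    and t: "0 < t" "t \<le> \<sigma> - L * \<epsilon>"
  shows "locally_strongly_aligned F U S xs (\<lambda>\<rho>. \<rho> / (4 * L / \<sigma>\<^sup>2)) \<epsilon> (t\<^sup>2)"
proof -
  let ?m = "DIM('a)" and ?C = "4 * L / \<sigma>\<^sup>2"
  have C: "0 < ?C" using L \<sigma> by simp
  have svd_at: "is_svd (nabla F x) (U x) (S x) (V x)" for x
    using svd by (simp add: svd_family_def)
  have "\<exists>j\<in>{1..min DIM('a) DIM('b)}.
           norm ((F x - F xs) - orth_proj (span (U x ` {1..j})) (F x - F xs))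
             \<le> \<rho> * norm (F x - F xs) \<and> t\<^sup>2 \<le> (S x j)\<^sup>2"
    if \<rho>: "0 < \<rho>" and x: "x \<in> cball xs \<epsilon>" and z: "F x \<in> cball (F xs) (\<rho> / ?C)" for \<rho> x
  proof (intro bexI conjI)
    show "?m \<in> {1..min DIM('a) DIM('b)}" using dim by (simp add: Suc_leI)
    let ?h = "x - xs" and ?z = "F x - F xs"
    have h: "norm ?h \<le> \<epsilon>" using x by (simp add: dist_norm norm_minus_commute)
    have zC: "norm ?z \<le> \<rho> / ?C" using z by (simp only: mem_cball dist_norm norm_minus_commute)
    have xr: "x \<in> cball xs r" "xs \<in> cball xs r" using x \<epsilon> by auto

    have lin: "norm (?z - blinfun_apply (nabla F x0) ?h) \<le> L * (norm ?h)\<^sup>2"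
      if "x0 \<in> closed_segment xs x" for x0
      using linearization_bound[OF diff lip xr(1) that] L by simp

    have "\<sigma> * norm ?h \<le> norm (blinfun_apply (nabla F xs) ?h)"
      using is_svd_last_lower[OF svd_at dim] \<sigma> by simp
    also have "\<dots> \<le> norm ?z + L * (norm ?h)\<^sup>2"
      using lin[of xs] norm_triangle_ineq3[of ?z "blinfun_apply (nabla F xs) ?h"] by simp
    also have "L * (norm ?h)\<^sup>2 \<le> \<sigma> / 2 * norm ?h"
    proof -
      have "norm ?h \<le> \<sigma> / (2 * L)" using h \<epsilon> by simp
      then have "L * norm ?h \<le> \<sigma> / 2" using L by (simp add: field_simps)
      then have "L * norm ?h * norm ?h \<le> \<sigma> / 2 * norm ?h" by (intro mult_right_mono) auto
      then show ?thesis by (simp add: power2_eq_square)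
    qed
    finally have hz: "norm ?h \<le> 2 / \<sigma> * norm ?z" using \<sigma> by (simp add: field_simps)

    have "norm (?z - orth_proj (span (U x ` {1..?m})) ?z) \<le> norm (?z - blinfun_apply (nabla F x) ?h)"
      by (intro orth_proj_span_nearest is_svd_range_subset[OF svd_at dim])
    also have "\<dots> \<le> L * (norm ?h)\<^sup>2" by (rule lin) simp
    also have "\<dots> \<le> L * (2 / \<sigma> * norm ?z)\<^sup>2"
      using L hz by (intro mult_left_mono power_mono) auto
    also have "\<dots> = ?C * norm ?z * norm ?z"
      by (simp add: power2_eq_square)
    also have "\<dots> \<le> \<rho> * norm ?z"
      using zC C by (intro mult_right_mono) (simp_all only: pos_le_divide_eq mult.commute norm_ge_zero)
    finally show "norm (?z - orth_proj (span (U x ` {1..?m})) ?z) \<le> \<rho> * norm ?z" .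

    \<comment> \<open>Weyl's inequality for the smallest singular value, by testing \<open>\<nabla>F(xs)\<close> on a unit vector
      that is extremal for \<open>\<nabla>F(x)\<close>.\<close>
    let ?v = "V x ?m"
    have v: "norm ?v = 1" "norm (blinfun_apply (nabla F x) ?v) = S x ?m"
      using is_svd_last_attained[OF svd_at dim] by auto
    have "\<sigma> \<le> norm (blinfun_apply (nabla F xs) ?v)"
      using is_svd_last_lower[OF svd_at dim, of xs ?v] \<sigma> v by simp
    also have "\<dots> \<le> S x ?m + norm (blinfun_apply (nabla F x - nabla F xs) ?v)"
      using norm_triangle_ineq3[of "blinfun_apply (nabla F x) ?v" "blinfun_apply (nabla F xs) ?v"] v
      by (simp add: blinfun.diff_left)
    also have "norm (blinfun_apply (nabla F x - nabla F xs) ?v) \<le> norm (nabla F x - nabla F xs)"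
      using norm_blinfun[of "nabla F x - nabla F xs" ?v] v by simp
    also have "\<dots> \<le> L * norm ?h" using xr by (rule lip)
    also have "\<dots> \<le> L * \<epsilon>" using h L by simp
    finally have "t \<le> S x ?m" using t by simp
    then show "t\<^sup>2 \<le> (S x ?m)\<^sup>2" using t by (intro power_mono) auto
  qed
  then show ?thesis
    unfolding locally_strongly_aligned_def
    using \<epsilon>(1) t(1) divide_pos_pos[OF _ C] by (simp only: zero_less_power) blast
qed

section \<open>The trilinear map behind the symmetric decomposition\<close>

definition cp3 :: "real^'r^'d \<Rightarrow> real^'r^'d \<Rightarrow> real^'r^'d \<Rightarrow> real^'d^'d^'d" where
  "cp3 A B C = (\<Sum>l\<in>UNIV. outer3 (column l A) (column l B) (column l C))"

lemma cp3_nth: "cp3 A B C $ i $ j $ k = (\<Sum>l\<in>UNIV. A $ i $ l * B $ j $ l * C $ k $ l)"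
  by (simp add: cp3_def outer3_def column_def)

lemma cp3_diff:
  "cp3 (A - A') B C = cp3 A B C - cp3 A' B C"
  "cp3 A (B - B') C = cp3 A B C - cp3 A B' C"
  "cp3 A B (C - C') = cp3 A B C - cp3 A B C'"
  by (simp_all add: vec_eq_iff cp3_nth sum_subtractf algebra_simps)

lemma norm_vec_scaleR:
  fixes z :: "'b::real_normed_vector"
  shows "norm (\<chi> i. a $ i *\<^sub>R z) = norm a * norm z"
  by (simp add: norm_vec_def L2_set_left_distrib)

lemma norm_outer3: "norm (outer3 w x y) = norm w * norm x * norm y"
proof -
  have "outer3 w x y = (\<chi> i. w $ i *\<^sub>R (\<chi> j. x $ j *\<^sub>R y))"
    by (simp add: outer3_def vec_eq_iff)
  then show ?thesis by (simp add: norm_vec_scaleR)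
qed

lemma norm_eq_L2_columns: "norm (A :: real^'r^'d) = L2_set (\<lambda>l. norm (column l A)) UNIV"
  unfolding norm_vec_def L2_set_def column_def
  by (simp add: sum_nonneg) (rule sum.swap)

text \<open>One factor is bounded by its largest column; for the other two, the columns are
  paired by the Cauchy--Schwarz inequality.\<close>

lemma norm_cp3_le: "norm (cp3 A B C) \<le> norm A * norm B * norm C"
proof -
  have col: "norm (column l C) \<le> norm C" for l
    unfolding norm_eq_L2_columns by (rule member_le_L2_set) auto
  have "norm (cp3 A B C) \<le> (\<Sum>l\<in>UNIV. norm (column l A) * norm (column l B) * norm (column l C))"
    unfolding cp3_def norm_outer3[symmetric] by (rule norm_sum)
  also have "\<dots> \<le> (\<Sum>l\<in>UNIV. \<bar>norm (column l A)\<bar> * \<bar>norm (column l B)\<bar>) * norm C"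
    unfolding sum_distrib_right by (intro sum_mono) (auto intro!: mult_left_mono col)
  also have "\<dots> \<le> norm A * norm B * norm C"
    unfolding norm_eq_L2_columns[of A] norm_eq_L2_columns[of B]
    by (intro mult_right_mono L2_set_mult_ineq) auto
  finally show ?thesis .
qed

lemma F_sym_eq_cp3: "F_sym X = cp3 X X X"
  by (simp add: F_sym_def cp3_def)

lemma has_derivative_vec_componentwise:
  fixes f :: "'a::real_normed_vector \<Rightarrow> 'b::euclidean_space^'n"
  assumes "\<And>i. ((\<lambda>x. f x $ i) has_derivative (\<lambda>h. f' h $ i)) (at x)"
  shows "(f has_derivative f') (at x)"
proof -
  have "((\<lambda>x. f x \<bullet> axis i u) has_derivative (\<lambda>h. f' h \<bullet> axis i u)) (at x)" for i u
    using has_derivative_inner_left[OF assms[of i]] by (simp add: inner_axis)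
  then show ?thesis
    unfolding has_derivative_componentwise_within[of f f' x UNIV] by (auto simp: Basis_vec_def)
qed

lemma F_sym_has_derivative:
  fixes X :: "real^'r^'d"
  shows "(F_sym has_derivative (\<lambda>H. cp3 H X X + cp3 X H X + cp3 X X H)) (at X)"
proof -
  have entry: "((\<lambda>X::real^'r^'d. X $ i $ l) has_derivative (\<lambda>H. H $ i $ l)) (at X)" for i l
    by (intro bounded_linear_imp_has_derivative bounded_linear_compose[OF bounded_linear_vec_nth]
        bounded_linear_vec_nth)
  show ?thesis
    unfolding F_sym_eq_cp3
    by (intro has_derivative_vec_componentwise)
      (auto simp: cp3_nth sum.distrib[symmetric] algebra_simps intro!: derivative_eq_intros entry)
qed

lemma F_sym_differentiable: "F_sym differentiable at X"
  using F_sym_has_derivative by (rule differentiableI)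

lemma nabla_F_sym: "blinfun_apply (nabla F_sym X) H = cp3 H X X + cp3 X H X + cp3 X X H"
  by (simp add: nabla_eqI[OF F_sym_has_derivative])

lemma nabla_F_sym_diff_le:
  "norm (nabla F_sym X - nabla F_sym X') \<le> 3 * (norm X + norm X') * norm (X - X')"
proof (rule norm_blinfun_bound)
  fix H
  let ?D = "X - X'"
  have "blinfun_apply (nabla F_sym X - nabla F_sym X') H =
      (cp3 H ?D X + cp3 H X' ?D) + (cp3 ?D H X + cp3 X' H ?D) + (cp3 ?D X H + cp3 X' ?D H)"
    by (simp add: blinfun.diff_left nabla_F_sym cp3_diff)
  also have "norm \<dots> \<le> (norm H * norm ?D * norm X + norm H * norm X' * norm ?D)
      + (norm ?D * norm H * norm X + norm X' * norm H * norm ?D)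
      + (norm ?D * norm X * norm H + norm X' * norm ?D * norm H)"
    by (intro norm_triangle_mono norm_cp3_le)
  also have "\<dots> = 3 * (norm X + norm X') * norm ?D * norm H"
    by (simp add: algebra_simps)
  finally show "norm (blinfun_apply (nabla F_sym X - nabla F_sym X') H)
      \<le> 3 * (norm X + norm X') * norm ?D * norm H" .
qed simp

lemma continuously_differentiable_F_sym:
  "continuously_differentiable (F_sym :: real^'r^'d \<Rightarrow> real^'d^'d^'d)"
  unfolding continuously_differentiable_def
proof (intro conjI allI F_sym_differentiable continuous_at_imp_continuous_on ballI)
  fix X :: "real^'r^'d"
  have "((\<lambda>Y. nabla F_sym Y - nabla F_sym X) \<longlongrightarrow> 0) (at X)"
  proof (rule Lim_null_comparison)
    show "\<forall>\<^sub>F Y in at X. norm (nabla F_sym Y - nabla F_sym X) \<le> 3 * (norm Y + norm X) * norm (Y - X)"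
      by (intro always_eventually allI nabla_F_sym_diff_le)
    have "((\<lambda>Y. 3 * (norm Y + norm X) * norm (Y - X)) \<longlongrightarrow> 3 * (norm X + norm X) * norm (X - X)) (at X)"
      by (intro tendsto_intros)
    then show "((\<lambda>Y. 3 * (norm Y + norm X) * norm (Y - X)) \<longlongrightarrow> 0) (at X)" by simp
  qed
  then show "isCont (nabla F_sym) X"
    unfolding isCont_def by (rule LIM_zero_cancel)
qed

lemma nabla_F_sym_Lipschitz_on_cball:
  assumes "X \<in> cball Xs (norm Xs)" "X' \<in> cball Xs (norm Xs)"
  shows "norm (nabla F_sym X - nabla F_sym X') \<le> 12 * norm Xs * norm (X - X')"
proof -
  have bound: "norm Y \<le> 2 * norm Xs" if "Y \<in> cball Xs (norm Xs)" for Y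
    using that norm_triangle_ineq2[of Y Xs] by (simp add: dist_norm norm_minus_commute)
  have "norm (nabla F_sym X - nabla F_sym X') \<le> 3 * (norm X + norm X') * norm (X - X')"
    by (rule nabla_F_sym_diff_le)
  also have "\<dots> \<le> 12 * norm Xs * norm (X - X')"
    using assms[THEN bound] by (intro mult_right_mono) auto
  finally show ?thesis .
qed

text \<open>Let \<open>B\<close> be a left inverse of \<open>X\<close>, with rows \<open>b\<^sub>p\<close>. Contracting the last two modes of
  \<open>\<nabla>F_sym(X) H\<close> with \<open>b\<^sub>p\<close> leaves \<open>H\<^sub>p + 2 * (b\<^sub>p \<bullet> H\<^sub>p) X\<^sub>p\<close>. If this vanishes, a further
  contraction with \<open>b\<^sub>p\<close> gives \<open>3 * (b\<^sub>p \<bullet> H\<^sub>p) = 0\<close>, hence \<open>H\<^sub>p = 0\<close>.\<close>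

lemma nabla_F_sym_injective:
  fixes X H :: "real^'r^'d"
  assumes rank: "rank X = CARD('r)" and zero: "blinfun_apply (nabla F_sym X) H = 0"
  shows "H = 0"
proof -
  obtain B :: "real^'d^'r" where "B ** X = mat 1"
    using rank full_rank_injective matrix_left_invertible_injective by blast
  then have dual: "(\<Sum>i\<in>UNIV. B $ p $ i * X $ i $ l) = (if p = l then 1 else 0)" for p l
    by (simp add: matrix_matrix_mult_def mat_def vec_eq_iff)
  define c where "c p l = (\<Sum>i\<in>UNIV. B $ p $ i * H $ i $ l)" for p l
  have contract: "(\<Sum>j\<in>UNIV. \<Sum>k\<in>UNIV. cp3 A1 A2 A3 $ i $ j $ k * (B $ p $ j * B $ p $ k)) =
      (\<Sum>l\<in>UNIV. A1 $ i $ l * (\<Sum>j\<in>UNIV. B $ p $ j * A2 $ j $ l) * (\<Sum>k\<in>UNIV. B $ p $ k * A3 $ k $ l))"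
    for A1 A2 A3 :: "real^'r^'d" and i p
  proof -
    have "(\<Sum>j\<in>UNIV. \<Sum>k\<in>UNIV. cp3 A1 A2 A3 $ i $ j $ k * (B $ p $ j * B $ p $ k)) =
      (\<Sum>j\<in>UNIV. \<Sum>k\<in>UNIV. \<Sum>l\<in>UNIV. A1 $ i $ l * (B $ p $ j * A2 $ j $ l) * (B $ p $ k * A3 $ k $ l))"
      by (simp add: cp3_nth sum_distrib_right sum_distrib_left mult_ac)
    also have "\<dots> = (\<Sum>j\<in>UNIV. \<Sum>l\<in>UNIV. \<Sum>k\<in>UNIV. A1 $ i $ l * (B $ p $ j * A2 $ j $ l) * (B $ p $ k * A3 $ k $ l))"
      by (intro sum.cong refl sum.swap)
    also have "\<dots> = (\<Sum>l\<in>UNIV. \<Sum>j\<in>UNIV. \<Sum>k\<in>UNIV. A1 $ i $ l * (B $ p $ j * A2 $ j $ l) * (B $ p $ k * A3 $ k $ l))"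
      by (rule sum.swap)
    finally show ?thesis
      by (simp only: sum_distrib_left[symmetric] sum_distrib_right[symmetric])
  qed
  have column: "H $ i $ p + 2 * c p p * X $ i $ p = 0" for i p
  proof -
    have "(\<Sum>j\<in>UNIV. \<Sum>k\<in>UNIV. (cp3 H X X + cp3 X H X + cp3 X X H) $ i $ j $ k * (B $ p $ j * B $ p $ k)) = 0"
      using zero unfolding nabla_F_sym by simp
    then have "(\<Sum>l\<in>UNIV. H $ i $ l * (if p = l then 1 else 0) * (if p = l then 1 else 0)) +
        (\<Sum>l\<in>UNIV. X $ i $ l * c p l * (if p = l then 1 else 0)) +
        (\<Sum>l\<in>UNIV. X $ i $ l * (if p = l then 1 else 0) * c p l) = 0"
      by (simp add: distrib_right sum.distrib contract dual c_def del: mult_eq_0_iff)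
    then show ?thesis
      by (simp add: if_distrib if_distribR cong: if_cong)
  qed
  have "c p p = 0" for p
  proof -
    have "(\<Sum>i\<in>UNIV. B $ p $ i * (H $ i $ p + 2 * c p p * X $ i $ p)) =
        (\<Sum>i\<in>UNIV. B $ p $ i * H $ i $ p) + 2 * c p p * (\<Sum>i\<in>UNIV. B $ p $ i * X $ i $ p)"
      by (simp add: distrib_left sum.distrib sum_distrib_left mult_ac)
    then show ?thesis by (simp add: column dual c_def[symmetric])
  qed
  then show ?thesis using column by (simp add: vec_eq_iff)
qed

section \<open>Strong alignment of the symmetric tensor map\<close>

theorem theorem5p16:
  fixes Xs :: "real^'r^'d"
  assumes "rank Xs = CARD('r)"
  defines "\<sigma> \<equiv> singular_value (nabla F_sym Xs) (CARD('d) * CARD('r))"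
  shows "continuously_differentiable (F_sym :: real^'r^'d \<Rightarrow> real^'d^'d^'d) \<and>
    (\<forall>X\<in>cball Xs (norm Xs). \<forall>X'\<in>cball Xs (norm Xs).
       norm (nabla F_sym X - nabla F_sym X') \<le> 12 * norm Xs * norm (X - X')) \<and>
    (\<exists>R>0. \<exists>C>0. \<forall>U S V. svd_family F_sym U S V \<longrightarrow>
       (let \<epsilon> = Min {R, \<sigma> / (24 * norm Xs), norm Xs}; \<delta> = (\<lambda>\<rho>. \<rho> / C) in
          locally_strongly_aligned F_sym U S Xs \<delta> \<epsilon> ((\<sigma> / 2)\<^sup>2) \<and>
          (1/2 < \<sigma> \<longrightarrow> locally_strongly_aligned F_sym U S Xs \<delta> \<epsilon> (\<sigma> / 2))))"
proof (intro conjI ballI continuously_differentiable_F_sym nabla_F_sym_Lipschitz_on_cball)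
  let ?L = "12 * norm Xs"
  have DIM: "DIM(real^'r^'d) = CARD('d) * CARD('r)" by simp
  have "CARD('r) \<le> CARD('d)"
    using rank_bound[of Xs] assms(1) by simp
  then have dim: "DIM(real^'r^'d) \<le> DIM(real^'d^'d^'d)"
    by (simp add: mult_le_mono le_trans[OF _ le_square])
  have "Xs \<noteq> 0" using assms(1) by (auto simp: rank_0)
  then have L: "0 < ?L" by simp

  have \<sigma>_eq: "\<sigma> = s DIM(real^'r^'d)" and \<sigma>_pos: "0 < \<sigma>" if svd: "is_svd (nabla F_sym Xs) u s v" for u s v
  proof -
    show eq: "\<sigma> = s DIM(real^'r^'d)"
      unfolding \<sigma>_def DIM[symmetric] by (rule singular_value_last[OF svd dim])
    note last = is_svd_last_attained[OF svd dim]
    have "v DIM(real^'r^'d) \<noteq> 0"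
      using last(1) by (metis norm_zero zero_neq_one)
    then have "blinfun_apply (nabla F_sym Xs) (v DIM(real^'r^'d)) \<noteq> 0"
      using nabla_F_sym_injective[OF assms(1)] by blast
    then show "0 < \<sigma>"
      using last(2) unfolding eq by (metis zero_less_norm_iff)
  qed

  \<comment> \<open>The radius at which the bound \<open>\<sigma> - ?L * \<epsilon>\<close> on the smallest singular value falls to
    \<open>sqrt (\<sigma> / 2)\<close>; for positive \<open>\<sigma>\<close> it is positive exactly when \<open>\<sigma> > 1/2\<close>. The value
    1 in the other case, and in \<open>C\<close> below, is a filler: the two constants have to be chosen before
    an SVD of the derivative is given, but \<open>0 < \<sigma>\<close> is derived from one.\<close>
  define R where "R = (if 1/2 < \<sigma> then (\<sigma> - sqrt (\<sigma> / 2)) / ?L else 1)"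
  have "sqrt (\<sigma> / 2) < \<sigma>" if "1/2 < \<sigma>"
    using that by (intro real_less_lsqrt) (auto simp: power2_eq_square)
  then have R: "0 < R" using L by (simp add: R_def)
  define C where "C = (if 0 < \<sigma> then 4 * ?L / \<sigma>\<^sup>2 else 1)"
  have C: "0 < C" using L by (simp add: C_def)

  show "\<exists>R>0. \<exists>C>0. \<forall>U S V. svd_family F_sym U S V \<longrightarrow>
       (let \<epsilon> = Min {R, \<sigma> / (24 * norm Xs), norm Xs}; \<delta> = (\<lambda>\<rho>. \<rho> / C) in
          locally_strongly_aligned F_sym U S Xs \<delta> \<epsilon> ((\<sigma> / 2)\<^sup>2) \<and>
          (1/2 < \<sigma> \<longrightarrow> locally_strongly_aligned F_sym U S Xs \<delta> \<epsilon> (\<sigma> / 2)))"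
  proof (rule exI[of _ R], intro conjI R, rule exI[of _ C], intro conjI C allI impI)
    fix U S V assume svd: "svd_family (F_sym :: real^'r^'d \<Rightarrow> real^'d^'d^'d) U S V"
    then have svd_Xs: "is_svd (nabla F_sym Xs) (U Xs) (S Xs) (V Xs)"
      by (simp add: svd_family_def)
    note \<sigma> = \<sigma>_eq[OF svd_Xs] \<sigma>_pos[OF svd_Xs]
    let ?\<epsilon> = "Min {R, \<sigma> / (24 * norm Xs), norm Xs}"
    have \<epsilon>: "0 < ?\<epsilon>" "?\<epsilon> \<le> norm Xs" "?\<epsilon> \<le> \<sigma> / (2 * ?L)" "?\<epsilon> \<le> R"
      using R L \<sigma>(2) by auto
    have aligned: "locally_strongly_aligned F_sym U S Xs (\<lambda>\<rho>. \<rho> / C) ?\<epsilon> (t\<^sup>2)"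
      if "0 < t" "t \<le> \<sigma> - ?L * ?\<epsilon>" for t
      using aligned_if_derivative_injective[OF dim F_sym_differentiable
          nabla_F_sym_Lipschitz_on_cball L svd \<sigma> \<epsilon>(1,2,3) that] \<sigma>(2)
      by (simp add: C_def)
    have "locally_strongly_aligned F_sym U S Xs (\<lambda>\<rho>. \<rho> / C) ?\<epsilon> ((\<sigma> / 2)\<^sup>2)"
    proof (rule aligned)
      show "0 < \<sigma> / 2" using \<sigma> by simp
      have "?L * ?\<epsilon> \<le> \<sigma> / 2"
        using mult_left_mono[OF \<epsilon>(3), of ?L] L by (simp del: Min_insert Min_le_iff)
      then show "\<sigma> / 2 \<le> \<sigma> - ?L * ?\<epsilon>" by linarith
    qed
    moreover have "locally_strongly_aligned F_sym U S Xs (\<lambda>\<rho>. \<rho> / C) ?\<epsilon> (\<sigma> / 2)" if "1/2 < \<sigma>"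
    proof -
      have "?L * ?\<epsilon> \<le> ?L * R" using \<epsilon>(4) L by (intro mult_left_mono) auto
      also have "\<dots> = \<sigma> - sqrt (\<sigma> / 2)" using that L by (simp add: R_def)
      finally have "sqrt (\<sigma> / 2) \<le> \<sigma> - ?L * ?\<epsilon>" by linarith
      then show ?thesis
        using aligned[of "sqrt (\<sigma> / 2)"] \<sigma>(2) by simp
    qed
    ultimately show "let \<epsilon> = ?\<epsilon>; \<delta> = (\<lambda>\<rho>. \<rho> / C) in
          locally_strongly_aligned F_sym U S Xs \<delta> \<epsilon> ((\<sigma> / 2)\<^sup>2) \<and>
          (1/2 < \<sigma> \<longrightarrow> locally_strongly_aligned F_sym U S Xs \<delta> \<epsilon> (\<sigma> / 2))"
      unfolding Let_def by blast
  qed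
qed

end
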